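(* Let $0\le\alpha<1$ and $\gamma>0$. The coefficients $f_m=f_m(\alpha,\gamma)$, $m\ge1$, satisfy, for every integer $m\ge 0$, the recursive formula $$f_{m+1}=(-1)^m\gamma^{-m-1}\sum_{i=0}^{m+1}S(m+1,i)(\gamma)_i\left(\frac{\alpha}{1-\alpha}\right)^i+\sum_{n=0}^{m}(-1)^{n+1}\gamma^{-n}\left[\sum_{i=0}^{n}S(n,i)(\gamma)_i\left(\frac{\alpha}{1-\alpha}\right)^i\right]\sum_{\substack{m\ge l_s>\cdots>l_1\ge1\\ l_1+\cdots+l_s=m+1-n}} f_{l_s}\cdots f_{l_1},$$ where the last sum is over all $s\ge 1$ and all strictly increasing tuples of integers as indicated (for $m=0$ it is empty, so that $f_1$ is given by the first term alone). Consequently, for $m\ge1$, $(1-\alpha)^{m+1}\gamma^{m}f_{m+1}$ is a polynomial in $\alpha,\gamma$ of degree $m$ in $\alpha$ and degree $m-1$ in $\gamma$.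
   Context: For $j\in\mathbb N$, $F_j:={}_2F_1(\gamma,j\gamma;1+j\gamma;\alpha)=\sum_{l\ge0}\alpha^l\frac{(\gamma)_l}{l!}\frac{j}{j+l/\gamma}$. The sequence $\{f_m(\alpha,\gamma)\}_{m\ge1}$ is the (unique) sequence, independent of $j$, such that for each $m\in\mathbb N$, $(1-\alpha)^{\gamma}\prod_{k=1}^{m}(1+f_k j^{-k})\,F_j=1+O(j^{-m-1})$ as $j\to\infty$. $S(n,i)$ is the Stirling number of the second kind (with $S(0,0)=1$), $(\gamma)_i=\gamma(\gamma+1)\cdots(\gamma+i-1)$ is the Pochhammer symbol, and $0^0=1$. *)

theory Defs
  imports "HOL-Analysis.Analysis" "HOL-Combinatorics.Stirling"
    "HOL-Computational_Algebra.Polynomial" "HOL-Library.Landau_Symbols"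
begin

definition hyp2F1 :: "real \<Rightarrow> real \<Rightarrow> real \<Rightarrow> real \<Rightarrow> real" where
  "hyp2F1 a b c z =
     (\<Sum>l. pochhammer a l * pochhammer b l / pochhammer c l * z ^ l / fact l)"

definition F :: "real \<Rightarrow> real \<Rightarrow> nat \<Rightarrow> real" where
  "F \<alpha> \<gamma> j = hyp2F1 \<gamma> (real j * \<gamma>) (1 + real j * \<gamma>) \<alpha>"

lemma F_series:
  assumes "\<gamma> > 0" and "j \<ge> 1"
  shows "F \<alpha> \<gamma> j =
    (\<Sum>l. \<alpha> ^ l * (pochhammer \<gamma> l / fact l) * (real j / (real j + real l / \<gamma>)))"
proof -
  define b where "b = real j * \<gamma>"
  have b: "b > 0" using assms by (simp add: b_def)
  have "pochhammer b l / pochhammer (1 + b) l = real j / (real j + real l / \<gamma>)" for l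
  proof -
    have p: "pochhammer (1 + b) l > 0" using b by (intro pochhammer_pos) simp
    have "b * pochhammer (1 + b) l = (b + real l) * pochhammer b l"
      by (metis pochhammer_rec pochhammer_rec' add.commute)
    then have "pochhammer b l / pochhammer (1 + b) l = b / (b + real l)"
      using b p by (simp add: field_simps)
    also have "\<dots> = real j / (real j + real l / \<gamma>)"
      using assms by (simp add: b_def field_simps)
    finally show ?thesis .
  qed
  then have "pochhammer \<gamma> l * pochhammer b l / pochhammer (1 + b) l * \<alpha> ^ l / fact l =
      \<alpha> ^ l * (pochhammer \<gamma> l / fact l) * (real j / (real j + real l / \<gamma>))" for l
    by (metis (no_types, lifting) mult.commute mult.assoc times_divide_eq_left times_divide_eq_right)
  then show ?thesis unfolding F_def hyp2F1_def b_def by simp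
qed

definition expansion_coeffs :: "real \<Rightarrow> real \<Rightarrow> (nat \<Rightarrow> real) \<Rightarrow> bool" where
  "expansion_coeffs \<alpha> \<gamma> f \<longleftrightarrow>
     (\<forall>m\<ge>1. (\<lambda>j::nat. (1 - \<alpha>) powr \<gamma> * (\<Prod>k=1..m. (1 + f k / real j ^ k)) * F \<alpha> \<gamma> j - 1)
        \<in> O(\<lambda>j. 1 / real j ^ (m + 1)))"

text \<open>The sequence is indexed by the positive integers. The unused value at index 0 is set to 0,
  without which the sequence could not be unique as a function on the naturals.\<close>

definition f_coeff :: "real \<Rightarrow> real \<Rightarrow> nat \<Rightarrow> real" where
  "f_coeff \<alpha> \<gamma> = (THE f. f 0 = 0 \<and> expansion_coeffs \<alpha> \<gamma> f)"

definition stirling_sum :: "real \<Rightarrow> real \<Rightarrow> nat \<Rightarrow> real" where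
  "stirling_sum \<alpha> \<gamma> n =
     (\<Sum>i=0..n. real (Stirling n i) * pochhammer \<gamma> i * (\<alpha> / (1 - \<alpha>)) ^ i)"

text \<open>A tuple \<open>l\<^sub>1 < \<dots> < l\<^sub>s\<close> is a strictly increasing list of length \<open>s\<close>.\<close>

definition incr_tuples :: "nat \<Rightarrow> nat \<Rightarrow> nat list set" where
  "incr_tuples m t =
     {ls. length ls \<ge> 1 \<and> sorted_wrt (<) ls \<and> set ls \<subseteq> {1..m} \<and> sum_list ls = t}"

text \<open>Bivariate polynomials are elements of \<open>\<real>[\<gamma>][\<alpha>]\<close>: the outer variable is \<open>\<alpha>\<close>, and the
  coefficients are polynomials in \<open>\<gamma>\<close>. Hence \<^const>\<open>degree\<close> is the degree in \<open>\<alpha>\<close>.\<close>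

definition eval2 :: "real poly poly \<Rightarrow> real \<Rightarrow> real \<Rightarrow> real" where
  "eval2 P \<alpha> \<gamma> = poly (poly P [:\<alpha>:]) \<gamma>"

definition inner_degree :: "real poly poly \<Rightarrow> nat" where
  "inner_degree P = (MAX i\<in>{..degree P}. degree (coeff P i))"

end

theory Submission
  imports Defs "HOL-Computational_Algebra.Polynomial_FPS"
begin

text \<open>
  Expanding \<open>1 / (1 + l / (\<gamma> j))\<close> as a geometric series and evaluating the moments
  \<open>\<Sum>l. l ^ n * \<alpha> ^ l * (\<gamma>)\<^sub>l / l!\<close> through Stirling numbers gives
  \<open>(1 - \<alpha>) powr \<gamma> * F \<alpha> \<gamma> j \<sim> \<Sum>n. c\<^sub>n / j ^ n\<close> with \<open>c\<^sub>n = (- 1 / \<gamma>) ^ n * T\<^sub>n\<close>, where \<open>T\<^sub>n\<close> is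
  the Stirling sum. So the \<open>f\<^sub>k\<close> are determined by the formal identity
  \<open>(\<Prod>k. 1 + f\<^sub>k X ^ k) * (\<Sum>n. c\<^sub>n X ^ n) = 1\<close>, whose coefficients yield the recursion.

  For the degrees, absorb the factor \<open>1 + f\<^sub>1 X = 1 + u X\<close>, \<open>u = \<alpha> / (1 - \<alpha>)\<close>, into the series. By the
  recurrence of the Stirling numbers its coefficients become
  \<open>c\<^sub>n\<^sub>+\<^sub>1 + u c\<^sub>n = (- 1 / \<gamma>) ^ (n + 1) * (1 + u) * (\<Sum>i\<le>n. i S(n, i) (\<gamma>)\<^sub>i u ^ i)\<close>. After rescaling
  \<open>X\<close> by \<open>(1 - \<alpha>) \<gamma>\<close> these are polynomials divisible by \<open>\<gamma>\<close>, of degree at most \<open>n\<close> in each variable,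
  and such bounds are inherited by the \<open>f\<^sub>k\<close>. The coefficient of \<open>\<alpha> ^ n * \<gamma> ^ n\<close> only sees the linear
  part of the recursion, and equals \<open>(-1) ^ n * n \<noteq> 0\<close>, so both degrees are attained.
\<close>

section \<open>Product expansions of formal power series\<close>

text \<open>The factor of index \<open>k\<close> is left out: these are exactly the factors known
  when the \<open>k\<close>-th one is chosen.\<close>

definition partial_product :: "(nat \<Rightarrow> 'a::comm_ring_1) \<Rightarrow> nat \<Rightarrow> 'a fps" where
  "partial_product f k = (\<Prod>i\<in>{1..<k}. 1 + fps_const (f i) * fps_X ^ i)"

text \<open>For a series with constant term 1, a further factor \<open>1 + c X ^ k\<close> changes
  no coefficient below \<open>k\<close> and adds \<open>c\<close> to the \<open>k\<close>-th one, so
  cancelling that coefficient forces \<open>c\<close> to be its negative. The product is written out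
  so that the termination argument sees calls only at indices below \<open>k\<close>.\<close>

fun product_coeff :: "'a::comm_ring_1 fps \<Rightarrow> nat \<Rightarrow> 'a" where
  "product_coeff A k =
     - fps_nth (A * (\<Prod>i\<in>{1..<k}. 1 + fps_const (product_coeff A i) * fps_X ^ i)) k"

declare product_coeff.simps [simp del]

lemma product_coeff_eq:
  "product_coeff A k = - fps_nth (A * partial_product (product_coeff A) k) k"
  by (subst product_coeff.simps) (simp add: partial_product_def)

lemma partial_product_1 [simp]: "partial_product f (Suc 0) = 1"
  by (simp add: partial_product_def)

lemma product_coeff_1: "product_coeff A 1 = - fps_nth A 1"
  using product_coeff_eq[of A 1] by simp

lemma partial_product_Suc:
  assumes "k \<ge> 1"
  shows "partial_product f (Suc k) = partial_product f k * (1 + fps_const (f k) * fps_X ^ k)"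
  using assms by (simp add: partial_product_def mult.commute)

lemma fps_nth_mult_factor:
  fixes A :: "'a::comm_ring_1 fps"
  shows "fps_nth (A * (1 + fps_const c * fps_X ^ k)) n =
    fps_nth A n + (if n < k then 0 else c * fps_nth A (n - k))"
proof -
  have "A * (1 + fps_const c * fps_X ^ k) = A + fps_const c * (A * fps_X ^ k)"
    by (simp add: algebra_simps)
  then show ?thesis by (simp add: fps_X_power_mult_right_nth)
qed

lemma fps_nth_factor:
  "fps_nth (1 + fps_const c * fps_X ^ k :: 'a::comm_ring_1 fps) n =
    (if n = 0 then 1 else 0) + (if n = k then c else 0)"
  by auto

lemma partial_product_nth_0 [simp]: "fps_nth (partial_product f k) 0 = 1"
proof -
  have "fps_nth (\<Prod>i\<in>S. 1 + fps_const (f i) * fps_X ^ i) 0 = 1" if "S \<subseteq> {1..<k}" for S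
    using that by (induction S rule: infinite_finite_induct) auto
  then show ?thesis by (simp add: partial_product_def)
qed

text \<open>Each coefficient is cancelled by the factor of its own index and stays zero, since later
  factors only act from their own index upwards.\<close>

lemma mult_partial_product_nth:
  assumes "fps_nth A 0 = 1" and "1 \<le> n" and "n < k"
  shows "fps_nth (A * partial_product (product_coeff A) k) n = 0"
  using assms(2,3)
proof (induction k)
  case 0
  then show ?case by simp
next
  case (Suc k)
  let ?B = "A * partial_product (product_coeff A) k"
  have "A * partial_product (product_coeff A) (Suc k) =
      ?B * (1 + fps_const (product_coeff A k) * fps_X ^ k)"
    using Suc.prems by (simp add: partial_product_Suc mult.assoc)
  then have eq: "fps_nth (A * partial_product (product_coeff A) (Suc k)) n =
      fps_nth ?B n + (if n < k then 0 else product_coeff A k * fps_nth ?B (n - k))"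
    by (simp only: fps_nth_mult_factor)
  show ?case
  proof (cases "n < k")
    case True
    then show ?thesis using Suc eq by simp
  next
    case False
    then have "n = k" using Suc.prems by simp
    then show ?thesis
      using eq assms(1) by (simp add: product_coeff_eq[of A k])
  qed
qed

text \<open>The first factor has already cancelled the coefficient of X, so the new series has the
  trivial first factor 1, and by induction both expansions share all later factors. This allows the
  Stirling recurrence to simplify the series before degrees are counted.\<close>

lemma product_coeff_divide_first:
  fixes A :: "'a::comm_ring_1 fps"
  assumes A0: "fps_nth A 0 = 1" and "k \<ge> 2"
  shows "product_coeff (A * (1 + fps_const (product_coeff A 1) * fps_X)) k = product_coeff A k"
  using \<open>k \<ge> 2\<close>
proof (induction k rule: less_induct)
  case (less k)
  let ?A' = "A * (1 + fps_const (product_coeff A 1) * fps_X)"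
  have "fps_nth ?A' 1 = 0"
    using fps_nth_mult_factor[of A "product_coeff A 1" 1 1]
    by (simp add: A0 product_coeff_1[simplified])
  then have z: "product_coeff ?A' 1 = 0"
    by (simp only: product_coeff_1 minus_zero)
  have split: "partial_product g k =
      (1 + fps_const (g 1) * fps_X) * (\<Prod>i\<in>{2..<k}. 1 + fps_const (g i) * fps_X ^ i)"
    for g :: "nat \<Rightarrow> 'a"
    unfolding partial_product_def using less.prems
    by (subst prod.atLeast_Suc_lessThan) (simp_all add: numeral_2_eq_2)
  have "(\<Prod>i\<in>{2..<k}. 1 + fps_const (product_coeff ?A' i) * fps_X ^ i) =
      (\<Prod>i\<in>{2..<k}. 1 + fps_const (product_coeff A i) * fps_X ^ i)"
    using less.IH by (intro prod.cong) auto
  then have "?A' * partial_product (product_coeff ?A') k = A * partial_product (product_coeff A) k"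
    unfolding split z by (simp add: mult.assoc)
  then show ?case
    by (simp only: product_coeff_eq[of _ k])
qed

text \<open>The hypothesis \<open>AB\<close> says that applying \<phi> to the coefficients of
  \<open>A\<close> gives \<open>B\<close> with X replaced by s X. Both operations respect products
  of series, hence the whole recursion. It transfers results about polynomial coefficients to their
  real values.\<close>

lemma product_coeff_hom_scale:
  fixes A :: "'a::comm_ring_1 fps" and B :: "'b::comm_ring_1 fps" and \<phi> :: "'a \<Rightarrow> 'b"
  assumes add: "\<And>x y. \<phi> (x + y) = \<phi> x + \<phi> y"
    and mult: "\<And>x y. \<phi> (x * y) = \<phi> x * \<phi> y"
    and one: "\<phi> 1 = 1"
    and AB: "\<And>n. \<phi> (fps_nth A n) = s ^ n * fps_nth B n"
  shows "\<phi> (product_coeff A k) = s ^ k * product_coeff B k"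
proof (induction k rule: less_induct)
  case (less k)
  define R where "R U V \<longleftrightarrow> (\<forall>n. \<phi> (fps_nth U n) = s ^ n * fps_nth V n)"
    for U :: "'a fps" and V :: "'b fps"
  have zero: "\<phi> 0 = 0" using add[of 0 0] by simp
  have minus: "\<phi> (- x) = - \<phi> x" for x
    using add[of x "- x"] zero by (simp add: minus_unique)
  have sum: "\<phi> (sum h S) = (\<Sum>i\<in>S. \<phi> (h i))" for h :: "nat \<Rightarrow> 'a" and S
    by (induction S rule: infinite_finite_induct) (simp_all add: zero add)
  have R_mult: "R (U * U') (V * V')" if "R U V" "R U' V'" for U U' V V'
    unfolding R_def
  proof
    fix n
    have "\<phi> (fps_nth (U * U') n) =
        (\<Sum>i=0..n. s ^ i * fps_nth V i * (s ^ (n - i) * fps_nth V' (n - i)))"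
      using that by (simp add: fps_mult_nth sum mult R_def)
    also have "\<dots> = (\<Sum>i=0..n. s ^ n * (fps_nth V i * fps_nth V' (n - i)))"
    proof (rule sum.cong)
      fix i assume "i \<in> {0..n}"
      then have "s ^ n = s ^ i * s ^ (n - i)" by (simp flip: power_add)
      then show "s ^ i * fps_nth V i * (s ^ (n - i) * fps_nth V' (n - i)) =
          s ^ n * (fps_nth V i * fps_nth V' (n - i))"
        by (simp add: ac_simps)
    qed simp
    finally show "\<phi> (fps_nth (U * U') n) = s ^ n * fps_nth (V * V') n"
      by (simp add: fps_mult_nth sum_distrib_left)
  qed
  have "R (\<Prod>i\<in>S. 1 + fps_const (product_coeff A i) * fps_X ^ i)
      (\<Prod>i\<in>S. 1 + fps_const (product_coeff B i) * fps_X ^ i)" if "S \<subseteq> {1..<k}" for S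
    using that
  proof (induction S rule: infinite_finite_induct)
    case (insert i S)
    have "R (1 + fps_const (product_coeff A i) * fps_X ^ i)
        (1 + fps_const (product_coeff B i) * fps_X ^ i)"
      unfolding R_def fps_nth_factor using insert.prems less.IH by (auto simp: add one zero)
    then show ?case using insert by (simp add: R_mult)
  qed (auto simp: R_def one zero dest: finite_subset)
  then have "R (A * partial_product (product_coeff A) k) (B * partial_product (product_coeff B) k)"
    unfolding partial_product_def using AB by (intro R_mult) (auto simp: R_def)
  then show ?case
    by (simp add: product_coeff_eq[of _ k] minus R_def)
qed

lemma fps_const_prod: "fps_const (prod f S) = (\<Prod>i\<in>S. fps_const (f i :: 'a::comm_ring_1))"
  by (induction S rule: infinite_finite_induct) (simp_all flip: fps_const_mult)

text \<open>Expanding the product chooses a subset of {1..m}, which contributes the power of X given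
  by its sum. Sorting identifies subsets with strictly increasing lists.\<close>

lemma partial_product_nth:
  fixes f :: "nat \<Rightarrow> 'a::comm_ring_1"
  assumes "t \<ge> 1"
  shows "fps_nth (partial_product f (Suc m)) t = (\<Sum>ls\<in>incr_tuples m t. prod_list (map f ls))"
proof -
  have "partial_product f (Suc m) = (\<Prod>i\<in>{1..m}. fps_const (f i) * fps_X ^ i + 1)"
    by (simp add: partial_product_def atLeastLessThanSuc_atLeastAtMost add.commute)
  also have "\<dots> = (\<Sum>S\<in>Pow {1..m}. \<Prod>i\<in>S. fps_const (f i) * fps_X ^ i)"
    by (subst prod_add) simp_all
  also have "\<dots> = (\<Sum>S\<in>Pow {1..m}. fps_const (prod f S) * fps_X ^ \<Sum>S)"
    by (intro sum.cong) (simp_all add: prod.distrib power_sum fps_const_prod)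
  finally have "fps_nth (partial_product f (Suc m)) t =
      (\<Sum>S\<in>Pow {1..m}. if t = \<Sum>S then prod f S else 0)"
    by (simp add: fps_sum_nth fps_X_power_nth if_distrib cong: if_cong)
  also have "\<dots> = (\<Sum>S | S \<subseteq> {1..m} \<and> \<Sum>S = t. prod f S)"
    by (subst sum.inter_filter[symmetric]) (auto intro: sum.cong)
  also have "\<dots> = (\<Sum>ls\<in>incr_tuples m t. prod_list (map f ls))"
  proof (rule sum.reindex_bij_witness[where i = set and j = sorted_list_of_set])
    fix S assume S: "S \<in> {S. S \<subseteq> {1..m} \<and> \<Sum>S = t}"
    then have fin: "finite S" using finite_subset by auto
    then show "set (sorted_list_of_set S) = S" by simp
    have "sum_list (sorted_list_of_set S) = \<Sum>S"
      using fin sum_list_distinct_conv_sum_set[of "sorted_list_of_set S" id] by simp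
    \<comment> \<open>The empty choice contributes only to X ^ 0, which matches the demand for
      nonempty tuples because t \<ge> 1.\<close>
    moreover have "S \<noteq> {}" using S assms by auto
    ultimately show "sorted_list_of_set S \<in> incr_tuples m t"
      using S fin unfolding incr_tuples_def
      by (auto simp: Suc_le_eq strict_sorted_list_of_set)
    show "prod_list (map f (sorted_list_of_set S)) = prod f S"
      using fin prod.distinct_set_conv_list[of "sorted_list_of_set S" f] by simp
  next
    fix ls assume ls: "ls \<in> incr_tuples m t"
    then have "sorted_wrt (<) ls" by (simp add: incr_tuples_def)
    then show "sorted_list_of_set (set ls) = ls"
      by (simp add: strict_sorted_equal)
    have "distinct ls" using \<open>sorted_wrt (<) ls\<close> strict_sorted_iff by blast
    then have "sum_list ls = \<Sum>(set ls)"
      using sum_list_distinct_conv_sum_set[of ls id] by simp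
    then show "set ls \<in> {S. S \<subseteq> {1..m} \<and> \<Sum>S = t}"
      using ls by (auto simp: incr_tuples_def)
  qed
  finally show ?thesis .
qed

text \<open>In the Cauchy product at X ^ (m + 1), the term n = m + 1 meets the constant term 1 of
  the partial product; in all other terms the remaining exponent is positive and the tuple formula
  applies.\<close>

lemma product_coeff_Suc:
  assumes "fps_nth A 0 = 1"
  shows "product_coeff A (Suc m) = - fps_nth A (Suc m) -
    (\<Sum>n=0..m. fps_nth A n * (\<Sum>ls\<in>incr_tuples m (Suc m - n). prod_list (map (product_coeff A) ls)))"
proof -
  have "fps_nth (A * partial_product (product_coeff A) (Suc m)) (Suc m) =
      (\<Sum>n=0..m. fps_nth A n * fps_nth (partial_product (product_coeff A) (Suc m)) (Suc m - n))
      + fps_nth A (Suc m)"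
    by (simp add: fps_mult_nth)
  also have "(\<Sum>n=0..m. fps_nth A n * fps_nth (partial_product (product_coeff A) (Suc m)) (Suc m - n))
      = (\<Sum>n=0..m. fps_nth A n * (\<Sum>ls\<in>incr_tuples m (Suc m - n). prod_list (map (product_coeff A) ls)))"
    by (intro sum.cong) (simp_all add: partial_product_nth)
  finally show ?thesis
    by (simp add: product_coeff_eq[of A "Suc m"])
qed

section \<open>Degrees in the two variables\<close>

text \<open>An upper bound over all coefficients, in contrast to the maximum in
  \<open>inner_degree\<close>, so that it passes easily to sums and products.\<close>

definition inner_degree_le :: "'a::comm_ring_1 poly poly \<Rightarrow> nat \<Rightarrow> bool" where
  "inner_degree_le p n \<longleftrightarrow> (\<forall>i. degree (coeff p i) \<le> n)"

lemma inner_degree_le_mono: "inner_degree_le p a \<Longrightarrow> a \<le> b \<Longrightarrow> inner_degree_le p b"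
  unfolding inner_degree_le_def using order.trans by blast

lemma inner_degree_le_mult: "inner_degree_le p a \<Longrightarrow> inner_degree_le q b \<Longrightarrow> inner_degree_le (p * q) (a + b)"
  unfolding inner_degree_le_def coeff_mult
  by (intro allI degree_sum_le order.trans[OF degree_mult_le] add_mono) auto

lemma inner_degree_le_power: "inner_degree_le p 0 \<Longrightarrow> inner_degree_le (p ^ n) 0"
proof (induction n)
  case (Suc n)
  then show ?case using inner_degree_le_mult[of p 0 "p ^ n" 0] by simp
qed (simp add: inner_degree_le_def flip: pCons_one add: coeff_pCons split: nat.split)

text \<open>
  A product of elements of levels \<open>a\<close> and \<open>b\<close> has \<open>\<alpha>\<close>-degree at most \<open>a + b - 2\<close>, so the corner
  coefficient (of \<open>\<alpha> ^ (n - 1) * \<gamma> ^ (n - 1)\<close>) vanishes on such products and hence is additive under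
  multiplication of graded series.
\<close>

definition filtration :: "nat \<Rightarrow> real poly poly set" where
  "filtration n = {p. degree p < n \<and> inner_degree_le p (n - 1) \<and> [:[:0, 1:]:] dvd p}"

abbreviation corner :: "nat \<Rightarrow> real poly poly \<Rightarrow> real" where
  "corner n p \<equiv> coeff (coeff p (n - 1)) (n - 1)"

lemma filtration_0: "n \<ge> 1 \<Longrightarrow> 0 \<in> filtration n"
  by (simp add: filtration_def inner_degree_le_def)

lemma filtration_add: "p \<in> filtration n \<Longrightarrow> q \<in> filtration n \<Longrightarrow> p + q \<in> filtration n"
  unfolding filtration_def inner_degree_le_def by (auto intro: degree_add_less degree_add_le)

lemma filtration_minus: "p \<in> filtration n \<Longrightarrow> - p \<in> filtration n"
  unfolding filtration_def inner_degree_le_def by auto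

lemma filtration_sum:
  "n \<ge> 1 \<Longrightarrow> (\<And>i. i \<in> S \<Longrightarrow> h i \<in> filtration n) \<Longrightarrow> sum h S \<in> filtration n"
  by (induction S rule: infinite_finite_induct) (auto intro: filtration_0 filtration_add)

lemma filtration_mult:
  assumes p: "p \<in> filtration a" and q: "q \<in> filtration b"
  shows "p * q \<in> filtration (a + b)" and "corner (a + b) (p * q) = 0"
proof -
  have deg: "degree (p * q) < a + b - 1"
    using degree_mult_le[of p q] p q unfolding filtration_def by auto
  have "inner_degree_le (p * q) (a - 1 + (b - 1))"
    using p q by (intro inner_degree_le_mult) (simp_all add: filtration_def)
  then have "inner_degree_le (p * q) (a + b - 1)"
    by (rule inner_degree_le_mono) simp
  then show "p * q \<in> filtration (a + b)"
    using p deg by (auto simp: filtration_def)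
  show "corner (a + b) (p * q) = 0"
    using deg by (simp add: coeff_eq_0)
qed

definition graded :: "real poly poly fps \<Rightarrow> bool" where
  "graded A \<longleftrightarrow> fps_nth A 0 = 1 \<and> (\<forall>n\<ge>1. fps_nth A n \<in> filtration n)"

text \<open>With both constant terms equal to 1, only the two end terms of the Cauchy product can
  reach the corner; the inner terms are products of two positive levels.\<close>

lemma graded_mult:
  assumes A: "graded A" and B: "graded B"
  shows "graded (A * B)"
    and "n \<ge> 1 \<Longrightarrow> corner n (fps_nth (A * B) n) = corner n (fps_nth A n) + corner n (fps_nth B n)"
proof -
  have eq: "fps_nth (A * B) n = fps_nth A n + fps_nth B n +
      (\<Sum>i\<in>{1..<n}. fps_nth A i * fps_nth B (n - i))" if "n \<ge> 1" for n
  proof -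
    have "{0..n} = insert 0 (insert n {1..<n})" using that by auto
    then show ?thesis
      using that A B by (simp add: fps_mult_nth graded_def)
  qed
  have D: "fps_nth A i * fps_nth B (n - i) \<in> filtration n"
      "corner n (fps_nth A i * fps_nth B (n - i)) = 0" if "i \<in> {1..<n}" for i n
    using filtration_mult[of "fps_nth A i" i "fps_nth B (n - i)" "n - i"] that A B
    by (auto simp: graded_def)
  show "graded (A * B)"
    unfolding graded_def
  proof (intro conjI allI impI)
    show "fps_nth (A * B) 0 = 1" using A B by (simp add: graded_def)
    fix n :: nat assume "n \<ge> 1"
    then show "fps_nth (A * B) n \<in> filtration n"
      using A B D(1) unfolding eq[OF \<open>n \<ge> 1\<close>]
      by (intro filtration_add filtration_sum) (auto simp: graded_def)
  qed
  show "corner n (fps_nth (A * B) n) = corner n (fps_nth A n) + corner n (fps_nth B n)" if "n \<ge> 1"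
    using D(2) by (simp add: eq[OF that] coeff_sum)
qed

text \<open>By induction the earlier factors are graded, and none of them has a term in X ^ k.
  Corners add up, so their product has corner 0 at level k, and only \<open>A\<close> itself
  contributes there.\<close>

lemma product_coeff_filtration:
  assumes A: "graded A" and "k \<ge> 1"
  shows "product_coeff A k \<in> filtration k \<and>
    corner k (product_coeff A k) = - corner k (fps_nth A k)"
  using \<open>k \<ge> 1\<close>
proof (induction k rule: less_induct)
  case (less k)
  have "graded (\<Prod>i\<in>S. 1 + fps_const (product_coeff A i) * fps_X ^ i) \<and>
      corner k (fps_nth (\<Prod>i\<in>S. 1 + fps_const (product_coeff A i) * fps_X ^ i) k) = 0"
    if "S \<subseteq> {1..<k}" for S
    using that
  proof (induction S rule: infinite_finite_induct)
    case (insert i S)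
    let ?U = "1 + fps_const (product_coeff A i) * fps_X ^ i"
    let ?P = "\<Prod>i\<in>S. 1 + fps_const (product_coeff A i) * fps_X ^ i"
    have "graded ?U" "fps_nth ?U k = 0"
      unfolding graded_def fps_nth_factor
      using insert.prems less.IH[of i] less.prems by (auto intro: filtration_0)
    moreover have P: "graded ?P" "corner k (fps_nth ?P k) = 0"
      using insert by auto
    ultimately show ?case
      using graded_mult(1)[OF _ P(1), of ?U] graded_mult(2)[OF _ P(1) less.prems, of ?U] insert.hyps
      by simp
  next
    case empty
    then show ?case using less.prems by (simp add: graded_def filtration_0)
  qed (auto dest: finite_subset)
  then have B: "graded (partial_product (product_coeff A) k)"
      "corner k (fps_nth (partial_product (product_coeff A) k) k) = 0"
    unfolding partial_product_def by auto
  have "fps_nth (A * partial_product (product_coeff A) k) k \<in> filtration k"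
    using graded_mult(1)[OF A B(1)] less.prems by (simp add: graded_def)
  then show ?case
    using graded_mult(2)[OF A B(1) less.prems] B(2)
    by (simp add: product_coeff_eq[of A k] filtration_minus)
qed

section \<open>Evaluation at real arguments and the explicit polynomial coefficients\<close>

lemma eval2_add: "eval2 (p + q) \<alpha> \<gamma> = eval2 p \<alpha> \<gamma> + eval2 q \<alpha> \<gamma>"
  and eval2_mult: "eval2 (p * q) \<alpha> \<gamma> = eval2 p \<alpha> \<gamma> * eval2 q \<alpha> \<gamma>"
  and eval2_minus: "eval2 (- p) \<alpha> \<gamma> = - eval2 p \<alpha> \<gamma>"
  and eval2_power: "eval2 (p ^ n) \<alpha> \<gamma> = eval2 p \<alpha> \<gamma> ^ n"
  and eval2_1: "eval2 1 \<alpha> \<gamma> = 1"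
  and eval2_const: "eval2 [:c:] \<alpha> \<gamma> = poly c \<gamma>"
  and eval2_sum: "eval2 (sum h S) \<alpha> \<gamma> = (\<Sum>i\<in>S. eval2 (h i) \<alpha> \<gamma>)"
  by (simp_all add: eval2_def poly_sum)

lemma poly_pochhammer: "poly (pochhammer p n) x = pochhammer (poly p x) n"
  by (simp add: pochhammer_prod poly_prod)

lemma pochhammer_X:
  fixes n :: nat
  shows "degree (pochhammer [:0, 1 :: real:] n) \<le> n" and "coeff (pochhammer [:0, 1 :: real:] n) n = 1"
proof (induction n)
  case (Suc n)
  have eq: "pochhammer [:0, 1 :: real:] (Suc n) = pochhammer [:0, 1:] n * [:real n, 1:]"
    by (simp add: pochhammer_Suc of_nat_poly)
  { case 1
    show ?case
      unfolding eq using degree_mult_le[of "pochhammer [:0, 1 :: real:] n" "[:real n, 1:]"] Suc(1)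
      by simp
  next
    case 2
    show ?case
      unfolding eq using Suc by (simp add: coeff_eq_0) }
qed simp_all

text \<open>This is i S(n, i) (\<gamma>)_i u ^ i with u = \<alpha> / (1 - \<alpha>), multiplied by
  (1 - \<alpha>) ^ n to clear the denominator; it is meant for i \<le> n.\<close>

definition scaled_term :: "nat \<Rightarrow> nat \<Rightarrow> real poly poly" where
  "scaled_term n i = [:smult (real i * real (Stirling n i)) (pochhammer [:0, 1:] i):] *
     ([:0, 1:] ^ i * [:1, -1:] ^ (n - i))"

lemma eval2_scaled_term:
  "eval2 (scaled_term n i) \<alpha> \<gamma> =
     real i * real (Stirling n i) * pochhammer \<gamma> i * \<alpha> ^ i * (1 - \<alpha>) ^ (n - i)"
proof -
  have "eval2 [:0, 1:] \<alpha> \<gamma> = \<alpha>" "eval2 [:1, -1:] \<alpha> \<gamma> = 1 - \<alpha>"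
    by (simp_all add: eval2_def)
  then show ?thesis
    unfolding scaled_term_def eval2_mult eval2_power eval2_const by (simp add: poly_pochhammer)
qed

lemma inner_degree_le_scaled_term: "inner_degree_le (scaled_term n i) i"
proof -
  have "inner_degree_le [:smult (real i * real (Stirling n i)) (pochhammer [:0, 1:] i):] i"
    unfolding inner_degree_le_def
    using pochhammer_X(1)[of i] degree_smult_le order.trans
    by (auto simp: coeff_pCons split: nat.split)
  moreover have "inner_degree_le ([:0, 1 :: real poly:] ^ i * [:1, -1:] ^ (n - i)) (0 + 0)"
    by (intro inner_degree_le_mult inner_degree_le_power) (auto simp: inner_degree_le_def coeff_pCons split: nat.split)
  ultimately show ?thesis
    unfolding scaled_term_def by (metis add_0_right inner_degree_le_mult)
qed

text \<open>Divisibility by \<gamma> comes from the first factor of (\<gamma>)_i if i > 0 and from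
  the factor i if i = 0. The \<gamma>-degree is at most i, so only i = n reaches the corner, where
  S(n, n) = 1 and (\<gamma>)_n is monic.\<close>

lemma scaled_term_filtration:
  assumes "i \<le> n"
  shows "scaled_term n i \<in> filtration (Suc n)"
    and "corner (Suc n) (scaled_term n i) = (if i = n then real n else 0)"
proof -
  have "degree ([:0, 1 :: real poly:] ^ i * [:1, -1:] ^ (n - i)) \<le> i + (n - i)"
    using degree_power_le[of "[:0, 1 :: real poly:]" i]
      degree_power_le[of "[:1, -1 :: real poly:]" "n - i"]
    by (intro order.trans[OF degree_mult_le] add_mono) simp_all
  then have deg: "degree (scaled_term n i) \<le> n"
    unfolding scaled_term_def using assms
    by (intro order.trans[OF degree_mult_le]) simp
  have "[:[:0, 1:]:] dvd scaled_term n i"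
  proof (cases i)
    case 0
    then show ?thesis by (simp add: scaled_term_def)
  next
    case (Suc k)
    then have "[:0, 1:] dvd smult (real i * real (Stirling n i)) (pochhammer [:0, 1:] i)"
      by (simp only: pochhammer_rec dvd_smult dvd_triv_left)
    then show ?thesis
      unfolding scaled_term_def by (intro dvd_mult2) (simp add: const_poly_dvd_iff coeff_pCons split: nat.split)
  qed
  then show "scaled_term n i \<in> filtration (Suc n)"
    using deg inner_degree_le_scaled_term[of n i] assms
    by (auto simp: filtration_def inner_degree_le_def intro: order.trans)
  show "corner (Suc n) (scaled_term n i) = (if i = n then real n else 0)"
  proof (cases "i = n")
    case True
    have "scaled_term n n = monom (smult (real n) (pochhammer [:0, 1:] n)) n"
      by (simp add: scaled_term_def monom_altdef)
    then show ?thesis using True pochhammer_X(2)[of n] by simp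
  next
    case False
    then have "degree (coeff (scaled_term n i) n) < n"
      using inner_degree_le_scaled_term[of n i] assms unfolding inner_degree_le_def
      by (meson le_neq_implies_less le_less_trans)
    then show ?thesis using False by (simp add: coeff_eq_0)
  qed
qed

text \<open>
  The series \<open>moment_series \<alpha> \<gamma> * (1 + f\<^sub>1 X)\<close> defined below, with \<open>X\<close> rescaled by \<open>(1 - \<alpha>) \<gamma>\<close>.
\<close>

definition scaled_series :: "real poly poly fps" where
  "scaled_series = Abs_fps (\<lambda>k. case k of 0 \<Rightarrow> 1
     | Suc n \<Rightarrow> if even n then - (\<Sum>i\<le>n. scaled_term n i) else (\<Sum>i\<le>n. scaled_term n i))"

lemma graded_scaled_series: "graded scaled_series"
  unfolding graded_def
proof (intro conjI allI impI)
  show "fps_nth scaled_series 0 = 1" by (simp add: scaled_series_def)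
  fix k :: nat assume "k \<ge> 1"
  then obtain n where "k = Suc n" by (cases k) auto
  moreover have "(\<Sum>i\<le>n. scaled_term n i) \<in> filtration (Suc n)"
    by (intro filtration_sum scaled_term_filtration) auto
  ultimately show "fps_nth scaled_series k \<in> filtration k"
    by (auto simp: scaled_series_def filtration_minus)
qed

lemma corner_scaled_series: "corner (Suc n) (fps_nth scaled_series (Suc n)) = - ((-1) ^ n * real n)"
proof -
  have "corner (Suc n) (\<Sum>i\<le>n. scaled_term n i) = (\<Sum>i\<le>n. if i = n then real n else 0)"
    unfolding coeff_sum using scaled_term_filtration(2)[of _ n] by (intro sum.cong) auto
  then have "corner (Suc n) (\<Sum>i\<le>n. scaled_term n i) = real n" by simp
  then show ?thesis by (simp add: scaled_series_def)
qed

text \<open>Dividing Q by \<gamma> keeps the \<alpha>-degree and lowers every nonzero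
  \<gamma>-degree bound by one. The nonzero corner becomes the coefficient of \<alpha> ^ m *
  \<gamma> ^ (m - 1) in P, so both bounds are attained.\<close>

lemma filtration_imp_degrees:
  assumes Q: "Q \<in> filtration (Suc m)" and c: "corner (Suc m) Q \<noteq> 0" and "m \<ge> 1"
  obtains P where "degree P = m" "inner_degree P = m - 1" "\<And>\<alpha> \<gamma>. eval2 Q \<alpha> \<gamma> = \<gamma> * eval2 P \<alpha> \<gamma>"
proof -
  from Q obtain P where P: "Q = [:[:0, 1:]:] * P"
    unfolding filtration_def by (auto elim: dvdE)
  then have coeff: "coeff Q i = pCons 0 (coeff P i)" for i by simp
  have "degree Q = degree P" unfolding P by (simp add: degree_mult_eq)
  moreover have "degree Q = m"
  proof (rule antisym)
    show "degree Q \<le> m" using Q by (simp add: filtration_def)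
    show "m \<le> degree Q" using c by (intro le_degree) auto
  qed
  ultimately have deg: "degree P = m" by simp
  have le: "degree (coeff P i) \<le> m - 1" for i
  proof -
    have "degree (pCons 0 (coeff P i)) \<le> m"
      using Q unfolding filtration_def inner_degree_le_def
      by (simp flip: coeff)
    then show ?thesis by (cases "coeff P i = 0") auto
  qed
  have "coeff (coeff P m) (m - 1) \<noteq> 0"
    using c \<open>m \<ge> 1\<close> by (simp add: coeff coeff_pCons')
  then have "degree (coeff P m) = m - 1"
    using le le_degree antisym by blast
  then have "inner_degree P = m - 1"
    unfolding inner_degree_def deg using le by (intro Max_eqI) (auto intro: rev_image_eqI)
  moreover have "eval2 Q \<alpha> \<gamma> = \<gamma> * eval2 P \<alpha> \<gamma>" for \<alpha> \<gamma>
    unfolding P eval2_mult eval2_const by simp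
  ultimately show ?thesis using that deg by blast
qed

section \<open>Stirling sums and moments\<close>

text \<open>The recurrence S(n + 1, i) = i S(n, i) + S(n, i - 1), transferred to the weights
  \<open>g\<close>. It serves both for falling factorials and for
  \<open>stirling_sum\<close>.\<close>

lemma sum_Stirling_Suc:
  fixes g :: "nat \<Rightarrow> real"
  shows "(\<Sum>i\<le>Suc n. real (Stirling (Suc n) i) * g i) =
    (\<Sum>i\<le>n. real (Stirling n i) * (real i * g i + g (Suc i)))"
proof -
  have "(\<Sum>i\<le>Suc n. real (Stirling (Suc n) i) * g i) =
      (\<Sum>i\<le>n. real (Suc i) * real (Stirling n (Suc i)) * g (Suc i)) +
      (\<Sum>i\<le>n. real (Stirling n i) * g (Suc i))"
    by (subst sum.atMost_Suc_shift) (simp add: sum.distrib algebra_simps)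
  also have "(\<Sum>i\<le>n. real (Suc i) * real (Stirling n (Suc i)) * g (Suc i)) =
      (\<Sum>i\<le>Suc n. real i * real (Stirling n i) * g i)"
    by (subst sum.atMost_Suc_shift) simp
  also have "\<dots> = (\<Sum>i\<le>n. real i * real (Stirling n i) * g i)"
    by simp
  finally show ?thesis
    by (simp add: sum.distrib algebra_simps)
qed

text \<open>Multiplying the falling factorial of length i by l = i + (l - i) yields i times itself
  plus the one of length i + 1, which is the pattern of the Stirling recurrence.\<close>

lemma power_eq_sum_Stirling:
  "real l ^ n = (\<Sum>i\<le>n. real (Stirling n i) * (\<Prod>s<i. real l - real s))"
proof (induction n)
  case (Suc n)
  have "real l ^ Suc n = (\<Sum>i\<le>n. real (Stirling n i) * (real l * (\<Prod>s<i. real l - real s)))"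
    by (simp add: Suc sum_distrib_left algebra_simps)
  also have "\<dots> = (\<Sum>i\<le>n. real (Stirling n i) *
      (real i * (\<Prod>s<i. real l - real s) + (\<Prod>s<Suc i. real l - real s)))"
    by (simp add: algebra_simps)
  finally show ?case
    by (simp only: sum_Stirling_Suc)
qed simp

lemma binomial_series_neg:
  assumes "\<bar>\<alpha>\<bar> < (1::real)"
  shows "(\<lambda>l. \<alpha> ^ l * (pochhammer \<gamma> l / fact l)) sums (1 - \<alpha>) powr (- \<gamma>)"
proof -
  have "(-\<gamma> gchoose l) * (-\<alpha>) ^ l = \<alpha> ^ l * (pochhammer \<gamma> l / fact l)" for l
  proof -
    have "(-\<alpha>) ^ l = (-1) ^ l * \<alpha> ^ l" by (metis mult_minus1 power_mult_distrib)
    moreover have "(-1 :: real) ^ l * (-1) ^ l = 1" by (simp flip: power_mult_distrib)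
    ultimately show ?thesis by (simp add: gbinomial_pochhammer)
  qed
  then show ?thesis
    using gen_binomial_real[of "-\<alpha>" "-\<gamma>"] assms by simp
qed

text \<open>The falling factorial kills the terms with l < i and cancels against l! in the others.
  After a shift by i, what remains is \<alpha> ^ i (\<gamma>)_i times the binomial series with
  parameter \<gamma> + i.\<close>

lemma factorial_moment_sums:
  assumes \<alpha>: "0 \<le> \<alpha>" "\<alpha> < (1::real)"
  shows "(\<lambda>l. \<alpha> ^ l * (pochhammer \<gamma> l / fact l) * (\<Prod>s<i. real l - real s)) sums
    ((1 - \<alpha>) powr (- \<gamma>) * pochhammer \<gamma> i * (\<alpha> / (1 - \<alpha>)) ^ i)"
proof -
  have zero: "(\<Prod>s<i. real l - real s) = 0" if "l < i" for l
    using that by (auto intro!: prod_zero)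
  have fact: "(\<Prod>s<i. real (l + i) - real s) = fact (l + i) / fact l" for l
  proof (induction i)
    case (Suc i)
    have "(\<Prod>s<Suc i. real (l + Suc i) - real s) =
        real (l + Suc i) * (\<Prod>s<i. real (l + i) - real s)"
      by (subst prod.lessThan_Suc_shift) simp
    then show ?case unfolding Suc by (simp add: field_simps)
  qed simp
  have "(\<lambda>l. \<alpha> ^ i * pochhammer \<gamma> i * (\<alpha> ^ l * (pochhammer (\<gamma> + real i) l / fact l))) sums
      (\<alpha> ^ i * pochhammer \<gamma> i * (1 - \<alpha>) powr (- (\<gamma> + real i)))"
    using \<alpha> by (intro sums_mult binomial_series_neg) simp
  also have "(\<lambda>l. \<alpha> ^ i * pochhammer \<gamma> i * (\<alpha> ^ l * (pochhammer (\<gamma> + real i) l / fact l))) =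
      (\<lambda>l. \<alpha> ^ (l + i) * (pochhammer \<gamma> (l + i) / fact (l + i)) * (\<Prod>s<i. real (l + i) - real s))"
    unfolding fact by (rule ext) (simp add: power_add pochhammer_product'[of \<gamma> i, symmetric] add.commute[of i])
  also have "\<alpha> ^ i * pochhammer \<gamma> i * (1 - \<alpha>) powr (- (\<gamma> + real i)) =
      (1 - \<alpha>) powr (- \<gamma>) * pochhammer \<gamma> i * (\<alpha> / (1 - \<alpha>)) ^ i"
  proof -
    have "(1 - \<alpha>) powr (- (\<gamma> + real i)) = (1 - \<alpha>) powr (- \<gamma>) / (1 - \<alpha>) ^ i"
      using \<alpha> by (simp add: powr_diff powr_realpow flip: diff_conv_add_uminus)
    then show ?thesis by (simp add: power_divide)
  qed
  finally show ?thesis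
    by (subst (asm) sums_iff_shift) (simp add: zero)
qed

lemma moment_sums:
  assumes "0 \<le> \<alpha>" "\<alpha> < (1::real)"
  shows "(\<lambda>l. \<alpha> ^ l * (pochhammer \<gamma> l / fact l) * real l ^ n) sums
    ((1 - \<alpha>) powr (- \<gamma>) * stirling_sum \<alpha> \<gamma> n)"
proof -
  have "(\<lambda>l. \<Sum>i\<le>n. real (Stirling n i) *
        (\<alpha> ^ l * (pochhammer \<gamma> l / fact l) * (\<Prod>s<i. real l - real s))) sums
      (\<Sum>i\<le>n. real (Stirling n i) * ((1 - \<alpha>) powr (- \<gamma>) * pochhammer \<gamma> i * (\<alpha> / (1 - \<alpha>)) ^ i))"
    using assms by (intro sums_sum sums_mult factorial_moment_sums)
  then show ?thesis
    by (simp add: power_eq_sum_Stirling stirling_sum_def sum_distrib_left atMost_atLeast0 ac_simps)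
qed

text \<open>From (\<gamma>)_(i+1) = (\<gamma> + i) (\<gamma>)_i and 1 + u = 1 / (1 - \<alpha>),
  where u = \<alpha> / (1 - \<alpha>). The part \<gamma> u T_n is separated because the factor 1 + u
  X removes exactly that part.\<close>

lemma stirling_sum_Suc:
  assumes "\<alpha> < 1"
  shows "stirling_sum \<alpha> \<gamma> (Suc n) = \<gamma> * (\<alpha> / (1 - \<alpha>)) * stirling_sum \<alpha> \<gamma> n +
    (\<Sum>i\<le>n. real i * real (Stirling n i) * pochhammer \<gamma> i * (\<alpha> / (1 - \<alpha>)) ^ i) / (1 - \<alpha>)"
proof -
  define u where "u = \<alpha> / (1 - \<alpha>)"
  have u: "1 / (1 - \<alpha>) = 1 + u" using assms by (simp add: u_def field_simps)
  have "stirling_sum \<alpha> \<gamma> (Suc n) =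
      (\<Sum>i\<le>n. real (Stirling n i) * (real i * (pochhammer \<gamma> i * u ^ i) + pochhammer \<gamma> (Suc i) * u ^ Suc i))"
    using sum_Stirling_Suc[of n "\<lambda>i. pochhammer \<gamma> i * u ^ i"]
    by (simp add: stirling_sum_def u_def atMost_atLeast0 mult.assoc)
  also have "\<dots> = (\<Sum>i\<le>n. \<gamma> * u * (real (Stirling n i) * pochhammer \<gamma> i * u ^ i) +
      (1 + u) * (real i * real (Stirling n i) * pochhammer \<gamma> i * u ^ i))"
    by (intro sum.cong) (simp_all add: pochhammer_Suc algebra_simps)
  also have "\<dots> = \<gamma> * u * stirling_sum \<alpha> \<gamma> n +
      (1 / (1 - \<alpha>)) * (\<Sum>i\<le>n. real i * real (Stirling n i) * pochhammer \<gamma> i * u ^ i)"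
    unfolding u by (simp add: sum.distrib sum_distrib_left stirling_sum_def u_def atMost_atLeast0)
  finally show ?thesis by (simp add: u_def)
qed

text \<open>The asymptotic expansion of \<open>(1 - \<alpha>) powr \<gamma> * F \<alpha> \<gamma> j\<close> in powers of \<open>X = 1 / j\<close>.\<close>

definition moment_series :: "real \<Rightarrow> real \<Rightarrow> real fps" where
  "moment_series \<alpha> \<gamma> = Abs_fps (\<lambda>n. (- 1 / \<gamma>) ^ n * stirling_sum \<alpha> \<gamma> n)"

lemma moment_series_0 [simp]: "fps_nth (moment_series \<alpha> \<gamma>) 0 = 1"
  by (simp add: moment_series_def stirling_sum_def)

lemma product_coeff_moment_series_1:
  assumes "\<gamma> > 0"
  shows "product_coeff (moment_series \<alpha> \<gamma>) 1 = \<alpha> / (1 - \<alpha>)"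
  unfolding product_coeff_1 using assms by (simp add: moment_series_def stirling_sum_def)

text \<open>For k = n + 1, one power of 1 - \<alpha> cancels the denominator in
  \<open>stirling_sum_Suc\<close> and the other n clear the powers of \<alpha> / (1 - \<alpha>); the
  powers of \<gamma> cancel, leaving the sign (-1) ^ (n + 1).\<close>

lemma eval2_scaled_series:
  assumes "\<alpha> < 1" and "\<gamma> > 0"
  shows "eval2 (fps_nth scaled_series k) \<alpha> \<gamma> = ((1 - \<alpha>) * \<gamma>) ^ k *
    fps_nth (moment_series \<alpha> \<gamma> * (1 + fps_const (\<alpha> / (1 - \<alpha>)) * fps_X)) k"
proof (cases k)
  case 0
  then show ?thesis by (simp add: scaled_series_def eval2_1)
next
  case (Suc n)
  define R where "R = (\<Sum>i\<le>n. real i * real (Stirling n i) * pochhammer \<gamma> i * (\<alpha> / (1 - \<alpha>)) ^ i)"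
  have "fps_nth (moment_series \<alpha> \<gamma> * (1 + fps_const (\<alpha> / (1 - \<alpha>)) * fps_X)) (Suc n) =
      (- 1 / \<gamma>) ^ Suc n * (stirling_sum \<alpha> \<gamma> (Suc n) - \<gamma> * (\<alpha> / (1 - \<alpha>)) * stirling_sum \<alpha> \<gamma> n)"
    using fps_nth_mult_factor[of "moment_series \<alpha> \<gamma>" "\<alpha> / (1 - \<alpha>)" 1 "Suc n"] assms
    by (simp add: moment_series_def field_simps)
  also have "\<dots> = (- 1 / \<gamma>) ^ Suc n * (R / (1 - \<alpha>))"
    unfolding stirling_sum_Suc[OF assms(1)] R_def by simp
  finally have "((1 - \<alpha>) * \<gamma>) ^ k *
      fps_nth (moment_series \<alpha> \<gamma> * (1 + fps_const (\<alpha> / (1 - \<alpha>)) * fps_X)) k =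
      ((1 - \<alpha>) * \<gamma> * (- 1 / \<gamma>)) ^ Suc n * (R / (1 - \<alpha>))"
    by (simp only: Suc power_mult_distrib mult.assoc)
  also have "(1 - \<alpha>) * \<gamma> * (- 1 / \<gamma>) = - (1 - \<alpha>)"
    using assms by simp
  also have "(- (1 - \<alpha>)) ^ Suc n * (R / (1 - \<alpha>)) = (-1) ^ Suc n * ((1 - \<alpha>) ^ n * R)"
    unfolding power_minus[of "1 - \<alpha>"] using assms by simp
  also have "(1 - \<alpha>) ^ n * R = (\<Sum>i\<le>n. eval2 (scaled_term n i) \<alpha> \<gamma>)"
    unfolding R_def sum_distrib_left
  proof (rule sum.cong)
    fix i assume "i \<in> {..n}"
    then have "(1 - \<alpha>) ^ n = (1 - \<alpha>) ^ (n - i) * (1 - \<alpha>) ^ i" by (simp flip: power_add)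
    then show "(1 - \<alpha>) ^ n * (real i * real (Stirling n i) * pochhammer \<gamma> i * (\<alpha> / (1 - \<alpha>)) ^ i) =
        eval2 (scaled_term n i) \<alpha> \<gamma>"
      using assms by (simp add: eval2_scaled_term power_divide)
  qed simp
  finally show ?thesis
    by (simp add: Suc scaled_series_def eval2_minus eval2_sum)
qed

text \<open>The range starts at k = 2 because the first factor has been absorbed into the
  series.\<close>

lemma product_coeff_moment_series_eval2:
  assumes "\<alpha> < 1" and "\<gamma> > 0" and "k \<ge> 2"
  shows "((1 - \<alpha>) * \<gamma>) ^ k * product_coeff (moment_series \<alpha> \<gamma>) k =
    eval2 (product_coeff scaled_series k) \<alpha> \<gamma>"
proof -
  have "product_coeff (moment_series \<alpha> \<gamma> * (1 + fps_const (\<alpha> / (1 - \<alpha>)) * fps_X)) k =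
      product_coeff (moment_series \<alpha> \<gamma>) k"
    using product_coeff_divide_first[OF moment_series_0 assms(3), of \<alpha> \<gamma>]
      product_coeff_moment_series_1[OF assms(2)] by simp
  then show ?thesis
    using product_coeff_hom_scale[of "\<lambda>p. eval2 p \<alpha> \<gamma>" scaled_series, OF eval2_add eval2_mult
        eval2_1 eval2_scaled_series[OF assms(1,2)]] by simp
qed

text \<open>Truncating the geometric series of 1 / (1 + y) after y ^ m leaves an error of at most y
  ^ (m + 1) for y \<ge> 0. Summed over l with y = l / (\<gamma> j), this error is a convergent
  moment of order m + 1, so no uniformity in l is required.\<close>

lemma hypergeometric_remainder:
  assumes \<alpha>: "0 \<le> \<alpha>" "\<alpha> < 1" and \<gamma>: "\<gamma> > 0" and j: "j \<ge> 1"
  shows "\<bar>(1 - \<alpha>) powr \<gamma> * F \<alpha> \<gamma> j -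
      (\<Sum>n\<le>m. fps_nth (moment_series \<alpha> \<gamma>) n * (1 / real j) ^ n)\<bar>
    \<le> stirling_sum \<alpha> \<gamma> (Suc m) / \<gamma> ^ Suc m * (1 / real j ^ (m + 1))"
proof -
  define a where "a l = \<alpha> ^ l * (pochhammer \<gamma> l / fact l)" for l
  define y where "y l = real l / (\<gamma> * real j)" for l
  define T where "T = stirling_sum \<alpha> \<gamma>"
  define w where "w = (1 - \<alpha>) powr \<gamma>"
  have w: "w > 0" "w * (1 - \<alpha>) powr (- \<gamma>) = 1"
    using \<alpha> by (simp_all add: w_def powr_minus)
  have a: "a l \<ge> 0" for l
    using \<alpha> \<gamma> by (simp add: a_def pochhammer_nonneg)
  have y: "y l \<ge> 0" for l
    using \<gamma> by (simp add: y_def)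
  have mom: "(\<lambda>l. a l * y l ^ n) sums ((1 - \<alpha>) powr (- \<gamma>) * T n * (1 / (\<gamma> * real j)) ^ n)" for n
    using sums_mult2[OF moment_sums[OF \<alpha>, of \<gamma> n], of "(1 / (\<gamma> * real j)) ^ n"]
    by (simp add: a_def y_def T_def power_divide mult.assoc)
  \<comment> \<open>The zeroth moment serves as a convergent majorant.\<close>
  have "norm (a l / (1 + y l)) \<le> a l * y l ^ 0" for l
  proof -
    have "a l / (1 + y l) \<le> a l / 1"
      using a[of l] y[of l] by (intro divide_left_mono) auto
    then show ?thesis using a[of l] y[of l] by simp
  qed
  then have "summable (\<lambda>l. a l / (1 + y l))"
    by (rule summable_comparison_test'[OF sums_summable[OF mom[of 0]], where N = 0])
  moreover have "F \<alpha> \<gamma> j = (\<Sum>l. a l / (1 + y l))"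
  proof -
    have "real j / (real j + real l / \<gamma>) = 1 / (1 + y l)" for l
    proof -
      have "1 + y l = (real j + real l / \<gamma>) / real j"
        using j by (simp add: y_def add_divide_distrib)
      then show ?thesis by simp
    qed
    then show ?thesis
      unfolding F_series[OF \<gamma> j] a_def by simp
  qed
  ultimately have "(\<lambda>l. a l / (1 + y l)) sums F \<alpha> \<gamma> j"
    by (simp add: summable_sums)
  moreover have "(\<lambda>l. \<Sum>n\<le>m. (-1) ^ n * (a l * y l ^ n)) sums
      (\<Sum>n\<le>m. (-1) ^ n * ((1 - \<alpha>) powr (- \<gamma>) * T n * (1 / (\<gamma> * real j)) ^ n))"
    by (intro sums_sum sums_mult mom)
  ultimately have diff: "(\<lambda>l. a l / (1 + y l) - (\<Sum>n\<le>m. (-1) ^ n * (a l * y l ^ n))) sums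
      (F \<alpha> \<gamma> j - (\<Sum>n\<le>m. (-1) ^ n * ((1 - \<alpha>) powr (- \<gamma>) * T n * (1 / (\<gamma> * real j)) ^ n)))"
    (is "?r sums ?R") by (rule sums_diff)
  have r: "\<bar>?r l\<bar> \<le> a l * y l ^ Suc m" for l
  proof -
    have "(1 + y l) * (\<Sum>n\<le>m. (- y l) ^ n) = 1 - (- y l) ^ Suc m"
      using sum_gp_basic[of "- y l" m] by simp
    then have "1 / (1 + y l) - (\<Sum>n\<le>m. (- y l) ^ n) = (- y l) ^ Suc m / (1 + y l)"
      using y[of l] by (simp add: field_simps)
    moreover have "?r l = a l * (1 / (1 + y l) - (\<Sum>n\<le>m. (- y l) ^ n))"
      unfolding right_diff_distrib sum_distrib_left power_minus[of "y l"] by (simp add: mult.left_commute)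
    ultimately have "\<bar>?r l\<bar> = a l * (y l ^ Suc m / (1 + y l))"
      using a[of l] y[of l] by (simp add: abs_mult power_abs del: power_Suc)
    also have "\<dots> \<le> a l * y l ^ Suc m"
      using a[of l] divide_left_mono[of 1 "1 + y l" "y l ^ Suc m"] y[of l]
      by (intro mult_left_mono) (simp_all del: power_Suc)
    finally show ?thesis .
  qed
  have "?R \<le> (1 - \<alpha>) powr (- \<gamma>) * T (Suc m) * (1 / (\<gamma> * real j)) ^ Suc m"
    by (rule sums_le[OF _ diff mom]) (rule abs_le_D1[OF r])
  moreover have "- ?R \<le> (1 - \<alpha>) powr (- \<gamma>) * T (Suc m) * (1 / (\<gamma> * real j)) ^ Suc m"
    by (rule sums_le[OF _ sums_minus[OF diff] mom]) (rule abs_le_D2[OF r])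
  ultimately have "\<bar>?R\<bar> \<le> (1 - \<alpha>) powr (- \<gamma>) * T (Suc m) * (1 / (\<gamma> * real j)) ^ Suc m"
    by linarith
  then have "w * \<bar>?R\<bar> \<le> w * ((1 - \<alpha>) powr (- \<gamma>) * T (Suc m) * (1 / (\<gamma> * real j)) ^ Suc m)"
    using w by (intro mult_left_mono) auto
  also have "\<dots> = (w * (1 - \<alpha>) powr (- \<gamma>)) * T (Suc m) / \<gamma> ^ Suc m * (1 / real j ^ (m + 1))"
    by (simp add: power_divide power_mult_distrib mult_ac)
  also have "w * \<bar>?R\<bar> = \<bar>w * ?R\<bar>"
    using w by (simp add: abs_mult)
  \<comment> \<open>The factor \<open>w\<close> cancels the
    \<open>(1 - \<alpha>) powr (- \<gamma>)\<close> common to all moments; regrouping the signs and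
    powers gives the coefficients of \<open>moment_series\<close>.\<close>
  also have "w * ?R = w * F \<alpha> \<gamma> j - (\<Sum>n\<le>m. (w * (1 - \<alpha>) powr (- \<gamma>)) * (- 1 / \<gamma>) ^ n * T n * (1 / real j) ^ n)"
  proof -
    have eq: "w * ((-1) ^ n * ((1 - \<alpha>) powr (- \<gamma>) * T n * (1 / (\<gamma> * real j)) ^ n)) =
        w * (1 - \<alpha>) powr (- \<gamma>) * (- 1 / \<gamma>) ^ n * T n * (1 / real j) ^ n" for n
    proof -
      have "(- 1 / \<gamma>) ^ n * (1 / real j) ^ n = (-1) ^ n * (1 / (\<gamma> * real j)) ^ n"
        by (simp flip: power_mult_distrib)
      then have "w * (1 - \<alpha>) powr (- \<gamma>) * T n * ((-1) ^ n * (1 / (\<gamma> * real j)) ^ n) =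
          w * (1 - \<alpha>) powr (- \<gamma>) * T n * ((- 1 / \<gamma>) ^ n * (1 / real j) ^ n)"
        by (simp only:)
      then show ?thesis by (simp only: mult_ac)
    qed
    show ?thesis
      unfolding right_diff_distrib sum_distrib_left eq ..
  qed
  finally show ?thesis
    unfolding w(2) by (simp add: moment_series_def w_def T_def)
qed

section \<open>Asymptotic expansion\<close>

lemma poly_inverse_bigo: "(\<lambda>j::nat. poly p (1 / real j)) \<in> O(\<lambda>_. 1)"
proof -
  have "(\<lambda>j::nat. poly p (1 / real j)) \<longlonglongrightarrow> poly p 0"
    by (intro tendsto_intros lim_1_over_n)
  then show ?thesis
    by (intro bigoI_tendsto[where c = "poly p 0"]) simp_all
qed

text \<open>Let p be the truncated series and q the finite product, both polynomials in x = 1 / j.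
  Then h q - 1 = (h - p) q + (p q - 1): the first term is small by the remainder estimate, the
  second because p q - 1 is divisible by x ^ (m + 1).\<close>

lemma expansion_coeffs_product_coeff:
  assumes \<alpha>: "0 \<le> \<alpha>" "\<alpha> < 1" and \<gamma>: "\<gamma> > 0"
    and f: "\<And>k. k \<ge> 1 \<Longrightarrow> f k = product_coeff (moment_series \<alpha> \<gamma>) k"
  shows "expansion_coeffs \<alpha> \<gamma> f"
  unfolding expansion_coeffs_def
proof (intro allI impI)
  fix m :: nat
  let ?A = "moment_series \<alpha> \<gamma>"
  define h where "h j = (1 - \<alpha>) powr \<gamma> * F \<alpha> \<gamma> j" for j
  define p where "p = (\<Sum>n\<le>m. monom (fps_nth ?A n) n)"
  define q where "q = (\<Prod>k=1..m. 1 + monom (f k) k)"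
  have p_coeff: "coeff p n = fps_nth ?A n" if "n \<le> m" for n
    using that by (simp add: p_def coeff_sum)
  have "fps_of_poly q = partial_product (product_coeff ?A) (Suc m)"
    by (simp add: q_def partial_product_def fps_of_poly_prod fps_of_poly_add fps_of_poly_monom f
        atLeastLessThanSuc_atLeastAtMost)
  then have q_coeff: "coeff q n = fps_nth (partial_product (product_coeff ?A) (Suc m)) n" for n
    by (metis fps_of_poly_nth)
  \<comment> \<open>Truncating the series at m affects only coefficients above m.\<close>
  have "coeff (p * q) n = fps_nth (?A * partial_product (product_coeff ?A) (Suc m)) n"
    if "n \<le> m" for n
    using that by (simp add: coeff_mult fps_mult_nth p_coeff q_coeff atMost_atLeast0)
  then have "coeff (p * q - 1) n = 0" if "n < m + 1" for n
    using that mult_partial_product_nth[of ?A n "Suc m"] by (cases n) simp_all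
  then have "monom 1 (m + 1) dvd p * q - 1"
    by (simp add: monom_1_dvd_iff')
  then obtain r where "p * q - 1 = monom 1 (m + 1) * r"
    by (elim dvdE)
  then have r: "poly p x * poly q x - 1 = x ^ (m + 1) * poly r x" for x
    by (metis mult.left_neutral poly_1 poly_diff poly_monom poly_mult)
  have poly_p: "poly p (1 / real j) = (\<Sum>n\<le>m. fps_nth ?A n * (1 / real j) ^ n)" for j :: nat
    by (simp add: p_def poly_sum poly_monom)
  have "eventually (\<lambda>j. norm (h j - poly p (1 / real j)) \<le>
      stirling_sum \<alpha> \<gamma> (Suc m) / \<gamma> ^ Suc m * norm (1 / real j ^ (m + 1))) sequentially"
    using eventually_ge_at_top[of 1]
  proof eventually_elim
    case (elim j)
    then show ?case
      using hypergeometric_remainder[OF \<alpha> \<gamma> elim, of m] by (simp add: h_def poly_p)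
  qed
  then have "(\<lambda>j. h j - poly p (1 / real j)) \<in> O(\<lambda>j. 1 / real j ^ (m + 1))"
    by (rule bigoI)
  then have "(\<lambda>j. (h j - poly p (1 / real j)) * poly q (1 / real j)) \<in> O(\<lambda>j. 1 / real j ^ (m + 1) * 1)"
    by (rule landau_o.big.mult) (rule poly_inverse_bigo)
  moreover have "(\<lambda>j. 1 / real j ^ (m + 1) * poly r (1 / real j)) \<in> O(\<lambda>j. 1 / real j ^ (m + 1) * 1)"
    by (rule landau_o.big.mult) (simp_all add: poly_inverse_bigo)
  ultimately have "(\<lambda>j. (h j - poly p (1 / real j)) * poly q (1 / real j) +
      1 / real j ^ (m + 1) * poly r (1 / real j)) \<in> O(\<lambda>j. 1 / real j ^ (m + 1) * 1)"
    by (rule sum_in_bigo)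
  moreover have "(1 - \<alpha>) powr \<gamma> * (\<Prod>k=1..m. (1 + f k / real j ^ k)) * F \<alpha> \<gamma> j - 1 =
      (h j - poly p (1 / real j)) * poly q (1 / real j) +
      1 / real j ^ (m + 1) * poly r (1 / real j)" for j
  proof -
    have "poly q (1 / real j) = (\<Prod>k=1..m. (1 + f k / real j ^ k))"
      by (simp add: q_def poly_prod poly_monom power_divide)
    moreover have "1 / real j ^ (m + 1) * poly r (1 / real j) =
        poly p (1 / real j) * poly q (1 / real j) - 1"
      by (simp only: r power_one_over)
    ultimately show ?thesis by (simp add: h_def algebra_simps)
  qed
  ultimately show "(\<lambda>j. (1 - \<alpha>) powr \<gamma> * (\<Prod>k=1..m. (1 + f k / real j ^ k)) * F \<alpha> \<gamma> j - 1)
      \<in> O(\<lambda>j. 1 / real j ^ (m + 1))"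
    by simp
qed

section \<open>Uniqueness of the expansion coefficients\<close>

lemma inverse_power_tendsto_0: "k \<ge> 1 \<Longrightarrow> (\<lambda>j::nat. 1 / real j ^ k) \<longlonglongrightarrow> 0"
  using tendsto_power[OF lim_1_over_n[where 'a = real], of k] by (simp add: power_one_over power_0_left)

lemma bigo_inverse_power_tendsto_0:
  fixes u :: "nat \<Rightarrow> real"
  assumes "u \<in> O(\<lambda>j. 1 / real j ^ k)" and "k \<ge> 1"
  shows "u \<longlonglongrightarrow> 0"
proof -
  have "(\<lambda>j::nat. 1 / real j ^ k) \<in> o(\<lambda>_. 1)"
    using inverse_power_tendsto_0[OF assms(2)] by (intro smalloI_tendsto) simp_all
  then have "u \<in> o(\<lambda>_. 1)"
    by (rule landau_o.big_small_trans[OF assms(1)])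
  then show ?thesis using smalloD_tendsto by fastforce
qed

text \<open>By induction both expansions share the product \<open>h\<close> of the earlier factors,
  and h tends to 1. Their difference times j ^ m is h (f m - g m), which is O(1 / j), so its limit f
  m - g m is 0.\<close>

lemma expansion_coeffs_unique:
  assumes f: "expansion_coeffs \<alpha> \<gamma> f" and g: "expansion_coeffs \<alpha> \<gamma> g" and "k \<ge> 1"
  shows "f k = g k"
  using \<open>k \<ge> 1\<close>
proof (induction k rule: less_induct)
  case (less m)
  define h where "h j = (1 - \<alpha>) powr \<gamma> * (\<Prod>k=1..<m. (1 + f k / real j ^ k)) * F \<alpha> \<gamma> j" for j
  have split: "(\<Prod>k=1..m. u k) = (\<Prod>k=1..<m. u k) * u m" for u :: "nat \<Rightarrow> real"
    using less.prems by (metis atLeastLessThanSuc_atLeastAtMost prod.atLeastLessThan_Suc)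
  have same: "(\<Prod>k=1..<m. (1 + g k / real j ^ k)) = (\<Prod>k=1..<m. (1 + f k / real j ^ k))" for j :: nat
    using less.IH by (intro prod.cong) auto
  have F: "(\<lambda>j. h j * (1 + f m / real j ^ m) - 1) \<in> O(\<lambda>j. 1 / real j ^ (m + 1))"
  proof -
    have "h j * (1 + f m / real j ^ m) =
        (1 - \<alpha>) powr \<gamma> * (\<Prod>k=1..m. (1 + f k / real j ^ k)) * F \<alpha> \<gamma> j" for j
      unfolding split h_def by (simp only: mult_ac)
    moreover have "(\<lambda>j. (1 - \<alpha>) powr \<gamma> * (\<Prod>k=1..m. (1 + f k / real j ^ k)) * F \<alpha> \<gamma> j - 1)
        \<in> O(\<lambda>j. 1 / real j ^ (m + 1))"
      using f less.prems unfolding expansion_coeffs_def by blast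
    ultimately show ?thesis by (simp only:)
  qed
  have G: "(\<lambda>j. h j * (1 + g m / real j ^ m) - 1) \<in> O(\<lambda>j. 1 / real j ^ (m + 1))"
  proof -
    have "h j * (1 + g m / real j ^ m) =
        (1 - \<alpha>) powr \<gamma> * (\<Prod>k=1..m. (1 + g k / real j ^ k)) * F \<alpha> \<gamma> j" for j
      unfolding split same h_def by (simp only: mult_ac)
    moreover have "(\<lambda>j. (1 - \<alpha>) powr \<gamma> * (\<Prod>k=1..m. (1 + g k / real j ^ k)) * F \<alpha> \<gamma> j - 1)
        \<in> O(\<lambda>j. 1 / real j ^ (m + 1))"
      using g less.prems unfolding expansion_coeffs_def by blast
    ultimately show ?thesis by (simp only:)
  qed
  have "(\<lambda>j. (h j * (1 + f m / real j ^ m) - 1) + 1) \<longlonglongrightarrow> 0 + 1"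
    by (intro tendsto_add tendsto_const bigo_inverse_power_tendsto_0[OF F]) simp
  moreover have one: "(\<lambda>j. 1 + f m / real j ^ m) \<longlonglongrightarrow> 1"
    using tendsto_add[OF tendsto_const
        tendsto_mult[OF tendsto_const inverse_power_tendsto_0[OF less.prems]], of 1 "f m"]
    by simp
  ultimately have "(\<lambda>j. h j * (1 + f m / real j ^ m) / (1 + f m / real j ^ m)) \<longlonglongrightarrow> 1"
    using tendsto_divide[of "\<lambda>j. h j * (1 + f m / real j ^ m)" 1 _ _ 1]
    by (simp only: diff_add_cancel add_0 div_by_1 one_neq_zero not_False_eq_True)
  \<comment> \<open>The factor tends to 1, hence is nonzero for large j and may be
    cancelled.\<close>
  moreover have "eventually (\<lambda>j. h j * (1 + f m / real j ^ m) / (1 + f m / real j ^ m) = h j) sequentially"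
    using tendsto_imp_eventually_ne[OF one, of 0] by (auto elim: eventually_mono)
  ultimately have h: "h \<longlonglongrightarrow> 1"
    by (rule Lim_transform_eventually)
  have "(\<lambda>j. (h j * (1 + f m / real j ^ m) - 1) - (h j * (1 + g m / real j ^ m) - 1))
      \<in> O(\<lambda>j. 1 / real j ^ (m + 1))"
    by (rule sum_in_bigo(2)[OF F G])
  then have "(\<lambda>j. ((h j * (1 + f m / real j ^ m) - 1) - (h j * (1 + g m / real j ^ m) - 1)) * real j ^ m)
      \<in> O(\<lambda>j. 1 / real j ^ (m + 1) * real j ^ m)"
    by (rule landau_o.big.mult) simp
  also have "?this \<longleftrightarrow> (\<lambda>j. h j * (f m - g m)) \<in> O(\<lambda>j. 1 / real j ^ 1)"
  proof (rule landau_o.big.cong_ex)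
    show "eventually (\<lambda>j. ((h j * (1 + f m / real j ^ m) - 1) - (h j * (1 + g m / real j ^ m) - 1)) * real j ^ m
        = h j * (f m - g m)) sequentially"
      using eventually_gt_at_top[of 0] by eventually_elim (simp add: field_simps)
    show "eventually (\<lambda>j. 1 / real j ^ (m + 1) * real j ^ m = 1 / real j ^ 1) sequentially"
      using eventually_gt_at_top[of 0] by eventually_elim simp
  qed
  finally have "(\<lambda>j. h j * (f m - g m)) \<longlonglongrightarrow> 0"
    by (rule bigo_inverse_power_tendsto_0) simp
  moreover have "(\<lambda>j. h j * (f m - g m)) \<longlonglongrightarrow> 1 * (f m - g m)"
    by (intro tendsto_mult h tendsto_const)
  ultimately show "f m = g m"
    using LIMSEQ_unique by fastforce
qed

lemma f_coeff_eq_product_coeff: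
  assumes "0 \<le> \<alpha>" "\<alpha> < 1" "\<gamma> > 0" and "k \<ge> 1"
  shows "f_coeff \<alpha> \<gamma> k = product_coeff (moment_series \<alpha> \<gamma>) k"
proof -
  \<comment> \<open>The recursion gives \<open>product_coeff\<close> the value -1 at index 0 here,
    so that value is replaced by the normalisation f 0 = 0.\<close>
  define f where "f k = (if k = 0 then 0 else product_coeff (moment_series \<alpha> \<gamma>) k)" for k
  have f: "f 0 = 0 \<and> expansion_coeffs \<alpha> \<gamma> f"
    using expansion_coeffs_product_coeff[OF assms(1-3), of f] by (simp add: f_def)
  have "f_coeff \<alpha> \<gamma> = f"
    unfolding f_coeff_def
  proof (rule the_equality[where P = "\<lambda>f. f 0 = 0 \<and> expansion_coeffs \<alpha> \<gamma> f", OF f])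
    fix g assume g: "g 0 = 0 \<and> expansion_coeffs \<alpha> \<gamma> g"
    show "g = f"
    proof
      fix k show "g k = f k"
        using f g expansion_coeffs_unique[of \<alpha> \<gamma> g f k] by (cases "k = 0") auto
    qed
  qed
  then show ?thesis using assms(4) by (simp add: f_def)
qed

section \<open>The recursive formula and the exact degrees\<close>

theorem proposition2p2:
  shows "(\<forall>\<alpha> \<gamma> :: real. 0 \<le> \<alpha> \<and> \<alpha> < 1 \<and> \<gamma> > 0 \<longrightarrow>
      (\<forall>m::nat. f_coeff \<alpha> \<gamma> (m + 1) =
         (-1) ^ m * \<gamma> powi (- int m - 1) * stirling_sum \<alpha> \<gamma> (m + 1)
         + (\<Sum>n=0..m. (-1) ^ (n + 1) * \<gamma> powi (- int n) * stirling_sum \<alpha> \<gamma> n *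
              (\<Sum>ls \<in> incr_tuples m (m + 1 - n). prod_list (map (f_coeff \<alpha> \<gamma>) ls)))))
    \<and> (\<forall>m::nat. m \<ge> 1 \<longrightarrow>
      (\<exists>P :: real poly poly. degree P = m \<and> inner_degree P = m - 1 \<and>
         (\<forall>\<alpha> \<gamma> :: real. 0 \<le> \<alpha> \<and> \<alpha> < 1 \<and> \<gamma> > 0 \<longrightarrow>
            (1 - \<alpha>) ^ (m + 1) * \<gamma> ^ m * f_coeff \<alpha> \<gamma> (m + 1) = eval2 P \<alpha> \<gamma>)))"
proof (intro conjI allI impI; (elim conjE)?)
  fix \<alpha> \<gamma> :: real and m :: nat
  assume asm: "0 \<le> \<alpha>" "\<alpha> < 1" "0 < \<gamma>"
  let ?A = "moment_series \<alpha> \<gamma>"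
  have powi: "\<gamma> powi (- int n) = (1 / \<gamma>) ^ n" for n
    by (simp add: power_int_minus power_one_over inverse_eq_divide)
  have neg: "(- 1 / \<gamma>) ^ n = (-1) ^ n * (1 / \<gamma>) ^ n" for n
    by (simp flip: power_mult_distrib)
  have "- int m - 1 = - int (Suc m)" by simp
  then have first: "- fps_nth ?A (Suc m) = (-1) ^ m * \<gamma> powi (- int m - 1) * stirling_sum \<alpha> \<gamma> (m + 1)"
    unfolding moment_series_def fps_nth_Abs_fps neg by (simp only: powi) simp
  have "- (fps_nth ?A n * (\<Sum>ls\<in>incr_tuples m (Suc m - n). prod_list (map (product_coeff ?A) ls))) =
      (-1) ^ (n + 1) * \<gamma> powi (- int n) * stirling_sum \<alpha> \<gamma> n *
        (\<Sum>ls \<in> incr_tuples m (m + 1 - n). prod_list (map (f_coeff \<alpha> \<gamma>) ls))" for n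
  proof -
    \<comment> \<open>Tuples contain only indices from 1 on, where the two sequences agree.\<close>
    have "map (product_coeff ?A) ls = map (f_coeff \<alpha> \<gamma>) ls" if "ls \<in> incr_tuples m t" for ls t
      using that asm by (auto simp: incr_tuples_def f_coeff_eq_product_coeff)
    then have "(\<Sum>ls\<in>incr_tuples m (Suc m - n). prod_list (map (product_coeff ?A) ls)) =
        (\<Sum>ls \<in> incr_tuples m (m + 1 - n). prod_list (map (f_coeff \<alpha> \<gamma>) ls))"
      by (intro sum.cong) (simp_all only: Suc_eq_plus1)
    moreover have "- fps_nth ?A n = (-1) ^ (n + 1) * \<gamma> powi (- int n) * stirling_sum \<alpha> \<gamma> n"
      unfolding powi moment_series_def fps_nth_Abs_fps neg by simp
    ultimately show ?thesis by (simp only: minus_mult_left)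
  qed
  then have rest: "- (\<Sum>n=0..m. fps_nth ?A n *
      (\<Sum>ls\<in>incr_tuples m (Suc m - n). prod_list (map (product_coeff ?A) ls))) =
      (\<Sum>n=0..m. (-1) ^ (n + 1) * \<gamma> powi (- int n) * stirling_sum \<alpha> \<gamma> n *
        (\<Sum>ls \<in> incr_tuples m (m + 1 - n). prod_list (map (f_coeff \<alpha> \<gamma>) ls)))"
    by (simp only: flip: sum_negf)
  have "f_coeff \<alpha> \<gamma> (m + 1) = - fps_nth ?A (Suc m) + - (\<Sum>n=0..m. fps_nth ?A n *
      (\<Sum>ls\<in>incr_tuples m (Suc m - n). prod_list (map (product_coeff ?A) ls)))"
    using f_coeff_eq_product_coeff[OF asm, of "Suc m"] product_coeff_Suc[of ?A m] by simp
  then show "f_coeff \<alpha> \<gamma> (m + 1) =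
      (-1) ^ m * \<gamma> powi (- int m - 1) * stirling_sum \<alpha> \<gamma> (m + 1)
      + (\<Sum>n=0..m. (-1) ^ (n + 1) * \<gamma> powi (- int n) * stirling_sum \<alpha> \<gamma> n *
           (\<Sum>ls \<in> incr_tuples m (m + 1 - n). prod_list (map (f_coeff \<alpha> \<gamma>) ls)))"
    unfolding first rest .
next
  fix m :: nat
  assume m: "m \<ge> 1"
  let ?Q = "product_coeff scaled_series (Suc m)"
  \<comment> \<open>The corner is nonzero because m \<ge> 1.\<close>
  have "?Q \<in> filtration (Suc m)" "corner (Suc m) ?Q = (-1) ^ m * real m"
    using product_coeff_filtration[OF graded_scaled_series, of "Suc m"] corner_scaled_series[of m]
    by simp_all
  then obtain P where P: "degree P = m" "inner_degree P = m - 1"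
      and Q: "\<And>\<alpha> \<gamma>. eval2 ?Q \<alpha> \<gamma> = \<gamma> * eval2 P \<alpha> \<gamma>"
    using filtration_imp_degrees[of ?Q m] m by auto
  have "(1 - \<alpha>) ^ (m + 1) * \<gamma> ^ m * f_coeff \<alpha> \<gamma> (m + 1) = eval2 P \<alpha> \<gamma>"
    if "0 \<le> \<alpha> \<and> \<alpha> < 1 \<and> \<gamma> > 0" for \<alpha> \<gamma>
  proof -
    \<comment> \<open>The rescaling carries \<gamma> ^ (m + 1), one power more than the claim; the
      extra \<gamma> matches the one split off from \<open>?Q\<close> and is cancelled using
      \<gamma> > 0.\<close>
    have "\<gamma> * ((1 - \<alpha>) ^ (m + 1) * \<gamma> ^ m * f_coeff \<alpha> \<gamma> (m + 1)) =
        ((1 - \<alpha>) * \<gamma>) ^ Suc m * product_coeff (moment_series \<alpha> \<gamma>) (Suc m)"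
      using f_coeff_eq_product_coeff[of \<alpha> \<gamma> "Suc m"] that by (simp add: power_mult_distrib)
    also have "\<dots> = \<gamma> * eval2 P \<alpha> \<gamma>"
      using product_coeff_moment_series_eval2[of \<alpha> \<gamma> "Suc m"] that m Q by simp
    finally have "\<gamma> * ((1 - \<alpha>) ^ (m + 1) * \<gamma> ^ m * f_coeff \<alpha> \<gamma> (m + 1)) = \<gamma> * eval2 P \<alpha> \<gamma>" .
    then show ?thesis using that by simp
  qed
  with P show "\<exists>P :: real poly poly. degree P = m \<and> inner_degree P = m - 1 \<and>
      (\<forall>\<alpha> \<gamma> :: real. 0 \<le> \<alpha> \<and> \<alpha> < 1 \<and> \<gamma> > 0 \<longrightarrow>
        (1 - \<alpha>) ^ (m + 1) * \<gamma> ^ m * f_coeff \<alpha> \<gamma> (m + 1) = eval2 P \<alpha> \<gamma>)"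
    by blast
qed

end
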